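(* Let $d$ be a positive integer and let $c,\beta$ be parameters with $c\notin\left\{0,\frac{1}{1-d},1\right\}$ (for $d=1$ this is read as $c\notin\{0,1\}$) and $\beta\neq-\frac nd$ for all integers $n\ge0$. Let $\{P_n\}_{n\ge0}$ be the $d$-orthogonal polynomial set generated by $$(1-t)^{-\beta d}\left(1+\frac{c-1}{dc}\left[\frac1{(1-t)^d}-1\right]\right)^{x}=\sum_{n=0}^\infty P_n(x)\frac{t^n}{n!}.$$ Then the $d$-dimensional functional vector $(u_0,u_1,\dots,u_{d-1})$ with respect to which the $d$-orthogonality of $\{P_n\}_{n\ge0}$ holds is given by $$\langle u_r,f\rangle=\frac1{r!}\sum_{i=0}^{r}\binom ri(-1)^i\sum_{j=0}^{\infty}\frac{\left(\beta+\frac id\right)_j\left(\frac{dc}{1-c}\right)^j}{\left(1-\frac{dc}{c-1}\right)^{\beta+\frac id+j}\,j!}\,f(j),$$ where $r=0,1,\dots,d-1$ and $f\in\mathcal P$.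
   Context: $\mathcal P$ is the vector space of polynomials in $x$ with complex coefficients and $\mathcal P'$ is its algebraic dual; $\langle u,f\rangle$ denotes the value of $u\in\mathcal P'$ at $f\in\mathcal P$. A polynomial set is a sequence $\{P_n\}_{n\ge0}$ in $\mathcal P$ with $\deg P_n=n$ for all $n\ge0$. For a positive integer $d$, a polynomial set $\{P_n\}_{n\ge0}$ is $d$-orthogonal with respect to a $d$-dimensional functional vector $(u_0,\dots,u_{d-1})$, $u_k\in\mathcal P'$, if for every $k\in\{0,1,\dots,d-1\}$ and every integer $n\ge0$: $\langle u_k,P_nP_m\rangle=0$ for all $m>nd+k$, and $\langle u_k,P_nP_{nd+k}\rangle\neq0$. It is called a $d$-orthogonal polynomial set if such a functional vector exists. Generating function identities are read as identities of power series in $t$. $(a)_n$ is the Pochhammer symbol: $(a)_0=1$, $(a)_n=a(a+1)\cdots(a+n-1)$ for $n\ge1$.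
   Formalization: The series for u_r converge for all polynomials f only when |dc/(1-c)| < |1-dc/(c-1)| (they diverge e.g. for d=1, c=2); the formula is proved there, and for the other allowed c the functionals are read as its analytic continuation in c. *)

theory Defs
  imports
    "HOL-Analysis.Analysis"
    "HOL-Computational_Algebra.Computational_Algebra"
begin

(* Isabelle gives the zero polynomial degree 0, so it has to be excluded explicitly (for n = 0). *)
definition polynomial_set :: "(nat \<Rightarrow> complex poly) \<Rightarrow> bool" where
  "polynomial_set P \<longleftrightarrow> (\<forall>n. P n \<noteq> 0 \<and> degree (P n) = n)"

(* Membership in the algebraic dual of the complex vector space of polynomials. *)
definition linear_functional :: "(complex poly \<Rightarrow> complex) \<Rightarrow> bool" where
  "linear_functional u \<longleftrightarrow> Vector_Spaces.linear smult (*) u"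

(* Only the entries u 0, ..., u (d - 1) of the family u matter. *)
definition d_orthogonal_wrt ::
    "nat \<Rightarrow> (nat \<Rightarrow> complex poly \<Rightarrow> complex) \<Rightarrow> (nat \<Rightarrow> complex poly) \<Rightarrow> bool" where
  "d_orthogonal_wrt d u P \<longleftrightarrow>
     polynomial_set P \<and>
     (\<forall>k<d. linear_functional (u k)) \<and>
     (\<forall>k<d. \<forall>n. (\<forall>m. m > n * d + k \<longrightarrow> u k (P n * P m) = 0) \<and>
                  u k (P n * P (n * d + k)) \<noteq> 0)"

(* The formal power series (1 + h)^a = (\<Sum>n. (a gchoose n) * h^n), for h with zero constant term. *)
definition fps_one_plus_powr :: "complex fps \<Rightarrow> complex \<Rightarrow> complex fps" where
  "fps_one_plus_powr h a = fps_binomial a oo h"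

definition generated_by :: "nat \<Rightarrow> complex \<Rightarrow> complex \<Rightarrow> (nat \<Rightarrow> complex poly) \<Rightarrow> bool" where
  "generated_by d \<beta> c P \<longleftrightarrow>
     (\<forall>x. fps_one_plus_powr (- fps_X) (- (\<beta> * of_nat d)) *
          fps_one_plus_powr
            (fps_const ((c - 1) / (of_nat d * c)) * (inverse ((1 - fps_X) ^ d) - 1)) x
        = Abs_fps (\<lambda>n. poly (P n) x / fact n))"

(* For d = 1 the convention 1 / 0 = 0 makes this the complement of {0, 1}, as required. *)
definition admissible :: "nat \<Rightarrow> complex set" where
  "admissible d = - {0, 1 / (1 - of_nat d), 1}"

(* The j-th term of the inner series; powr is the principal branch. *)
definition functional_term ::
    "nat \<Rightarrow> complex \<Rightarrow> complex \<Rightarrow> nat \<Rightarrow> complex poly \<Rightarrow> nat \<Rightarrow> complex" where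
  "functional_term d \<beta> c i f j =
     pochhammer (\<beta> + of_nat i / of_nat d) j * (of_nat d * c / (1 - c)) ^ j /
     ((1 - of_nat d * c / (c - 1)) powr (\<beta> + of_nat i / of_nat d + of_nat j) * fact j) *
     poly f (of_nat j)"

definition series_functional ::
    "nat \<Rightarrow> complex \<Rightarrow> complex \<Rightarrow> nat \<Rightarrow> complex poly \<Rightarrow> complex" where
  "series_functional d \<beta> c r f =
     1 / fact r *
     (\<Sum>i=0..r. of_nat (r choose i) * (-1) ^ i * (\<Sum>j. functional_term d \<beta> c i f j))"

(* The ratio of consecutive terms of the inner series tends to
   (d c / (1 - c)) / (1 - d c / (c - 1)), and for \<beta> + i/d not a nonpositive integer
   the series converges for every polynomial f iff this limit has modulus < 1. *)
definition convergence_domain :: "nat \<Rightarrow> complex set" where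
  "convergence_domain d =
     {c \<in> admissible d. norm (of_nat d * c / (1 - c)) < norm (1 - of_nat d * c / (c - 1))}"

(* U c r f is the analytic continuation in c of the series for \<langle>u_r, f\<rangle>. It is unique on
   admissible d: that set is open and connected, and contains the nonempty open set
   convergence_domain d. *)
definition continues_series_functional ::
    "nat \<Rightarrow> complex \<Rightarrow> (complex \<Rightarrow> nat \<Rightarrow> complex poly \<Rightarrow> complex) \<Rightarrow> bool" where
  "continues_series_functional d \<beta> U \<longleftrightarrow>
     (\<forall>r<d. \<forall>f. (\<lambda>c. U c r f) holomorphic_on admissible d \<and>
                 (\<forall>c\<in>convergence_domain d. U c r f = series_functional d \<beta> c r f))"

end

theory Submission
  imports Defs
begin

(* Both vectors and formal power series use the dollar sign; only the latter occur here. *)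
unbundle no vec_syntax

text \<open>
Put \<open>\<zeta> = dc / (c - 1)\<close> and \<open>\<delta>\<^sub>i = - \<beta> - i / d\<close>. The inner series of the theorem is the sum of \<open>f\<close>
against a normalised Meixner weight on the natural numbers, and on the binomial basis its value at
\<open>(x choose k)\<close> is \<open>(\<delta>\<^sub>i choose k) \<zeta>\<^sup>k\<close>. These values are polynomials in \<open>\<zeta>\<close>, so they define a
linear functional \<open>L\<^sub>i\<close> for every admissible \<open>c\<close> and give the analytic continuation. Inside the domain
of convergence the two agree by the binomial theorem (\<open>functional_term_sums\<close>).

Equivalently, \<open>L\<^sub>i\<close> maps \<open>(1 + y)^x\<close> to \<open>(1 + \<zeta> y)^\<delta>\<^sub>i\<close>, and more generally it maps
\<open>(x choose n) (1 + y)^x\<close> to a multiple of \<open>(1 + y)^n (1 + \<zeta> y)^(\<delta>\<^sub>i - n)\<close>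
(\<open>binomial_transform_meixner\<close>). In the generating function of \<open>P\<close> the variable \<open>y\<close> is the series
\<open>s(t)\<close> with \<open>\<zeta> s(t) = (1 - t)^(-d) - 1\<close>, and substituting it yields
\<open>\<Sum>m. L\<^sub>i ((x choose n) P\<^sub>m) t\<^sup>m / m! = (\<delta>\<^sub>i choose n) (1 - t)\<^sup>i (1 - (1 - \<zeta>) (1 - t)\<^sup>d)\<^sup>n\<close>,
a polynomial of degree exactly \<open>n d + i\<close> in \<open>t\<close> times a scalar
(\<open>meixner_functional_generating_function\<close>). The functional \<open>u\<^sub>r\<close> is a linear combination of
\<open>L\<^sub>0, \<dots>, L\<^sub>r\<close> in which \<open>L\<^sub>r\<close> has a nonzero coefficient. Hence \<open>u\<^sub>r ((x choose n) P\<^sub>m)\<close> vanishes for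
\<open>m > n d + r\<close>, and for \<open>m = n d + r\<close> it is a nonzero multiple of \<open>(\<delta>\<^sub>r choose n)\<close>, which the condition
on \<open>\<beta>\<close> keeps away from zero (\<open>continued_functional_on_basis\<close>). Expanding \<open>P\<^sub>n\<close> in the binomial basis
turns this into \<open>d\<close>-orthogonality.
\<close>

section \<open>The binomial basis and Newton expansion\<close>

lemma linear_functional_iff:
  "linear_functional u \<longleftrightarrow>
     (\<forall>f g. u (f + g) = u f + u g) \<and> (\<forall>a f. u (smult a f) = a * u f)"
  unfolding linear_functional_def Vector_Spaces.linear_def module_hom_def module_hom_axioms_def
    module_def vector_space_def
  by (auto simp: algebra_simps smult_add_left smult_add_right)

lemma linear_functional_add: "linear_functional u \<Longrightarrow> u (f + g) = u f + u g"
  and linear_functional_smult: "linear_functional u \<Longrightarrow> u (smult a f) = a * u f"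
  by (simp_all add: linear_functional_iff)

lemma linear_functional_diff: "linear_functional u \<Longrightarrow> u (f - g) = u f - u g"
  using linear_functional_add[of u "f - g" g] by (simp add: algebra_simps)

lemma linear_functional_sum: "linear_functional u \<Longrightarrow> u (\<Sum>i\<in>I. f i) = (\<Sum>i\<in>I. u (f i))"
  using linear_functional_smult[of u 0 0]
  by (induction I rule: infinite_finite_induct) (simp_all add: linear_functional_add)

definition binomial_poly :: "nat \<Rightarrow> complex poly" where
  "binomial_poly k = smult (1 / fact k) (\<Prod>i\<in>{0..<k}. [:- of_nat i, 1:])"

lemma poly_binomial_poly [simp]: "poly (binomial_poly k) x = x gchoose k"
  by (simp add: binomial_poly_def poly_prod gbinomial_prod_rev)

lemma degree_binomial_poly [simp]: "degree (binomial_poly k) = k"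
  and binomial_poly_nonzero [simp]: "binomial_poly k \<noteq> 0"
proof -
  have "degree (\<Prod>i\<in>{0..<k}. [:- of_nat i, 1 :: complex:]) = k"
    by (subst degree_prod_eq_sum_degree) auto
  then show "degree (binomial_poly k) = k"
    by (simp add: binomial_poly_def)
  show "binomial_poly k \<noteq> 0"
    by (simp add: binomial_poly_def)
qed

lemma binomial_poly_0 [simp]: "binomial_poly 0 = 1"
  by (simp add: binomial_poly_def)

lemma X_mult_binomial_poly:
  "[:0, 1:] * binomial_poly k =
     smult (of_nat k) (binomial_poly k) + smult (of_nat (Suc k)) (binomial_poly (Suc k))"
  by (rule poly_ext)
     (simp add: gbinomial_mult_1 del: of_nat_Suc)

text \<open>
Subtracting the right multiple of the basis element of top degree lowers the degree.
\<close>

lemma binomial_poly_expansion_exists: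
  "\<exists>a. f = (\<Sum>k\<le>n. smult (a k) (binomial_poly k))" if "degree f \<le> n"
  using that
proof (induction n arbitrary: f)
  case 0
  then obtain c where "f = [:c:]"
    by (metis degree_eq_zeroE le_zero_eq)
  then show ?case
    by (intro exI[of _ "\<lambda>_. c"]) simp
next
  case (Suc n)
  define l where "l = lead_coeff (binomial_poly (Suc n))"
  have l: "l \<noteq> 0" "coeff (binomial_poly (Suc n)) (Suc n) = l"
    using leading_coeff_0_iff[of "binomial_poly (Suc n)"] by (simp_all add: l_def)
  define b where "b = coeff f (Suc n) / l"
  define g where "g = f - smult b (binomial_poly (Suc n))"
  have "coeff g (Suc n) = 0"
    using l by (simp add: g_def b_def)
  moreover have "degree g \<le> Suc n"
    unfolding g_def using Suc.prems
    by (intro degree_diff_le order.trans[OF degree_smult_le]) auto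
  ultimately have "degree g \<le> n"
    by (metis le_Suc_eq leading_coeff_0_iff degree_0 le0)
  then obtain a where a: "g = (\<Sum>k\<le>n. smult (a k) (binomial_poly k))"
    using Suc.IH by blast
  have "f = g + smult b (binomial_poly (Suc n))"
    by (simp add: g_def)
  then have "f = (\<Sum>k\<le>Suc n. smult ((a(Suc n := b)) k) (binomial_poly k))"
    by (simp add: a)
  then show ?case by blast
qed

definition forward_diff :: "complex poly \<Rightarrow> complex poly" where
  "forward_diff f = pcompose f [:1, 1:] - f"

text \<open>
The functionals \<open>newton_coeff k\<close> are biorthogonal to the binomial basis. Reading the coordinates
of a polynomial off iterated differences makes their linearity immediate.
\<close>

definition newton_coeff :: "nat \<Rightarrow> complex poly \<Rightarrow> complex" where
  "newton_coeff k f = poly ((forward_diff ^^ k) f) 0"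

lemma linear_newton_coeff: "linear_functional (newton_coeff k)"
proof -
  have "(forward_diff ^^ k) (f + g) = (forward_diff ^^ k) f + (forward_diff ^^ k) g"
    and "(forward_diff ^^ k) (smult a f) = smult a ((forward_diff ^^ k) f)" for f g a
    by (induction k) (simp_all add: forward_diff_def pcompose_add pcompose_smult smult_diff_right)
  then show ?thesis
    by (simp add: linear_functional_iff newton_coeff_def)
qed

lemma forward_diff_binomial_poly:
  "forward_diff (binomial_poly k) = (if k = 0 then 0 else binomial_poly (k - 1))"
proof (cases k)
  case (Suc m)
  have "poly (forward_diff (binomial_poly k)) x = poly (binomial_poly m) x" for x
    using gbinomial_Suc_Suc[of x m]
    by (simp add: forward_diff_def poly_pcompose Suc add.commute)
  then have "forward_diff (binomial_poly k) = binomial_poly m"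
    by (rule poly_ext)
  then show ?thesis using Suc by simp
qed (simp add: forward_diff_def pcompose_1)

lemma newton_coeff_binomial_poly:
  "newton_coeff j (binomial_poly k) = (if j = k then 1 else 0)"
proof -
  have "(forward_diff ^^ j) (binomial_poly k) = (if j \<le> k then binomial_poly (k - j) else 0)"
  proof (induction j)
    case (Suc j)
    have "forward_diff 0 = 0" "forward_diff 1 = 0"
      by (simp_all add: forward_diff_def pcompose_1)
    with Suc show ?case
      by (simp add: forward_diff_binomial_poly)
  qed simp
  then show ?thesis
    by (auto simp: newton_coeff_def gbinomial_0_left)
qed

lemma newton_expansion:
  assumes "degree f \<le> n"
  shows "f = (\<Sum>k\<le>n. smult (newton_coeff k f) (binomial_poly k))"
proof -
  obtain a where a: "f = (\<Sum>k\<le>n. smult (a k) (binomial_poly k))"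
    using binomial_poly_expansion_exists[OF assms] by blast
  have "newton_coeff j f = a j" if "j \<le> n" for j
    using that
    by (subst a) (simp add: linear_functional_sum[OF linear_newton_coeff]
        linear_functional_smult[OF linear_newton_coeff] newton_coeff_binomial_poly if_distrib cong: if_cong)
  then show ?thesis
    by (subst a) (auto intro!: sum.cong)
qed

lemma newton_coeff_eq_0:
  assumes "degree f < k"
  shows "newton_coeff k f = 0"
proof -
  have "newton_coeff k f = newton_coeff k (\<Sum>j\<le>degree f. smult (newton_coeff j f) (binomial_poly j))"
    using newton_expansion[of f "degree f"] by simp
  then show ?thesis using assms
    by (simp add: linear_functional_sum[OF linear_newton_coeff]
        linear_functional_smult[OF linear_newton_coeff] newton_coeff_binomial_poly)
qed

text \<open>
A linear functional is prescribed by arbitrary values \<open>m k\<close> on the binomial basis. This is the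
form in which the series of the theorem makes sense outside its domain of convergence: its
values on the basis turn out to be polynomials in the parameter.
\<close>

definition functional_of_moments :: "(nat \<Rightarrow> complex) \<Rightarrow> complex poly \<Rightarrow> complex" where
  "functional_of_moments m f = (\<Sum>k\<le>degree f. newton_coeff k f * m k)"

text \<open>
The summation bound may be any bound on the degree, so that polynomials of different degrees
can be treated with a common bound.
\<close>

lemma functional_of_moments_eq:
  assumes "degree f \<le> n"
  shows "functional_of_moments m f = (\<Sum>k\<le>n. newton_coeff k f * m k)"
  unfolding functional_of_moments_def
  using assms by (intro sum.mono_neutral_left) (auto simp: newton_coeff_eq_0)

lemma linear_functional_of_moments: "linear_functional (functional_of_moments m)"
proof -
  note nc = linear_functional_add[OF linear_newton_coeff] linear_functional_smult[OF linear_newton_coeff]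
  have "functional_of_moments m (f + g) = functional_of_moments m f + functional_of_moments m g" for f g
  proof -
    let ?n = "max (degree f) (degree g)"
    have "degree (f + g) \<le> ?n" by (rule degree_add_le_max)
    then show ?thesis
      by (simp add: functional_of_moments_eq[of _ ?n] nc sum.distrib algebra_simps)
  qed
  moreover have "functional_of_moments m (smult a f) = a * functional_of_moments m f" for a f
    by (simp add: functional_of_moments_eq[of _ "degree f"] degree_smult_le nc sum_distrib_left
        mult.assoc)
  ultimately show ?thesis by (simp add: linear_functional_iff)
qed

lemma functional_of_moments_binomial_poly [simp]:
  "functional_of_moments m (binomial_poly k) = m k"
  by (simp add: functional_of_moments_def newton_coeff_binomial_poly if_distrib[of "\<lambda>x. x * _"]
      cong: if_cong)

section \<open>Complex powers of power series\<close>

lemma fps_binomial_deriv_mult: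
  fixes e :: complex
  shows "(1 + fps_X) * fps_deriv (fps_binomial e) = fps_const e * fps_binomial e"
proof -
  have "fps_deriv (fps_binomial e) = fps_const e * fps_binomial e * inverse (1 + fps_X)"
    by (simp add: fps_binomial_deriv fps_divide_unit)
  then show ?thesis
    using inverse_mult_eq_1[of "1 + fps_X :: complex fps"] by (simp add: mult_ac)
qed

text \<open>
This is the law \<open>((1 + X)^b)^e = (1 + X)^(b e)\<close> for complex exponents: the left-hand side \<open>F\<close>
satisfies the differential equation \<open>(1 + X) F' = b e F\<close> with \<open>F(0) = 1\<close>, whose only solution is
the binomial series.
\<close>

lemma fps_binomial_compose_binomial:
  fixes b e :: complex
  shows "fps_binomial e oo (fps_binomial b - 1) = fps_binomial (b * e)"
proof -
  define h where "h = fps_binomial b - 1"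
  have h0: "h $ 0 = 0" by (simp add: h_def)
  have one_h: "(1 + fps_X) oo h = fps_binomial b"
    by (simp add: h_def fps_compose_add_distrib)
  have dh: "(1 + fps_X) * fps_deriv h = fps_const b * fps_binomial b"
    by (simp add: h_def fps_binomial_deriv_mult)
  define F where "F = fps_binomial e oo h"
  have E: "fps_binomial b * (fps_deriv (fps_binomial e) oo h) = fps_const e * F"
    using arg_cong[OF fps_binomial_deriv_mult[of e], of "\<lambda>g. g oo h"]
    by (simp add: fps_compose_mult_distrib[OF h0] one_h F_def)
  have "(1 + fps_X) * fps_deriv F = fps_const b * (fps_binomial b * (fps_deriv (fps_binomial e) oo h))"
    using dh by (simp add: F_def fps_compose_deriv[OF h0] mult_ac)
  then have "(1 + fps_X) * fps_deriv F = fps_const (b * e) * F"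
    unfolding E by (simp flip: fps_const_mult add: mult_ac)
  then have "fps_deriv F = fps_const (b * e) * F / (1 + fps_X)"
    by (metis fps_one_nth fps_add_nth fps_X_nth add_0_right fps_zero_nth one_neq_zero
        nonzero_mult_div_cancel_left)
  then have "F = fps_const (F $ 0) * fps_binomial (b * e)"
    using fps_binomial_ODE_unique by blast
  then show ?thesis by (simp add: F_def h_def)
qed

lemma fps_deriv_binomial_shift:
  fixes e :: complex
  shows "fps_deriv (fps_binomial e) = fps_const e * fps_binomial (e - 1)"
  by (rule fps_ext) (use gbinomial_absorption[of _ e] in \<open>simp add: add.commute\<close>)

abbreviation one_minus_X_powr :: "complex \<Rightarrow> complex fps" where
  "one_minus_X_powr e \<equiv> fps_binomial e oo (- fps_X)"

lemma one_minus_X_powr_add: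
  "one_minus_X_powr (a + b) = one_minus_X_powr a * one_minus_X_powr b"
  by (simp add: fps_binomial_add_mult fps_compose_mult_distrib)

lemma one_minus_X_powr_of_nat: "one_minus_X_powr (of_nat n) = (1 - fps_X) ^ n"
  by (simp add: fps_binomial_of_nat fps_compose_add_distrib flip: fps_compose_power)

lemma one_minus_X_powr_minus_of_nat:
  "one_minus_X_powr (- of_nat n) = inverse ((1 - fps_X) ^ n)"
proof -
  have "one_minus_X_powr (- of_nat n) * (1 - fps_X) ^ n = 1"
    by (simp flip: one_minus_X_powr_of_nat one_minus_X_powr_add)
  then show ?thesis
    by (metis fps_inverse_unique mult.commute)
qed

lemma fps_binomial_compose_one_minus_X_powr:
  "fps_binomial e oo (one_minus_X_powr b - 1) = one_minus_X_powr (b * e)"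
proof -
  have "one_minus_X_powr b - 1 = (fps_binomial b - 1) oo (- fps_X)"
    by (simp add: fps_compose_sub_distrib)
  then have "fps_binomial e oo (one_minus_X_powr b - 1)
      = (fps_binomial e oo (fps_binomial b - 1)) oo (- fps_X)"
    by (simp add: fps_compose_assoc)
  then show ?thesis
    by (simp add: fps_binomial_compose_binomial)
qed

text \<open>
Since \<open>s\<close> has order at least one, only the powers \<open>s ^ k\<close> with \<open>k \<le> n\<close> contribute to the \<open>n\<close>-th
coefficient; the outer sum can therefore be taken over a range that does not depend on the
index of convolution.
\<close>

lemma fps_mult_compose_nth:
  fixes A F s :: "'a::idom fps"
  assumes "s $ 0 = 0"
  shows "(A * (F oo s)) $ n = (\<Sum>k\<le>n. F $ k * (A * s ^ k) $ n)"
proof -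
  have "(F oo s) $ (n - i) = (\<Sum>k\<le>n. F $ k * s ^ k $ (n - i))" for i
    unfolding fps_compose_nth using startsby_zero_power_prefix[OF assms]
    by (intro sum.mono_neutral_left) auto
  then have "(A * (F oo s)) $ n = (\<Sum>i\<le>n. \<Sum>k\<le>n. A $ i * (F $ k * s ^ k $ (n - i)))"
    by (simp add: fps_mult_nth atLeast0AtMost sum_distrib_left)
  also have "\<dots> = (\<Sum>k\<le>n. F $ k * (A * s ^ k) $ n)"
    by (subst sum.swap) (simp add: fps_mult_nth atLeast0AtMost sum_distrib_left mult_ac)
  finally show ?thesis .
qed

section \<open>Polynomials generated by $A(t)(1 + s(t))^x$\<close>

lemma generated_poly_expansion:
  assumes "\<And>x. A * (fps_binomial x oo s) = Abs_fps (\<lambda>n. poly (Q n) x)" and "s $ 0 = 0"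
  shows "Q n = (\<Sum>k\<le>n. smult ((A * s ^ k) $ n) (binomial_poly k))"
proof (rule poly_ext)
  fix x
  have "poly (Q n) x = (A * (fps_binomial x oo s)) $ n"
    by (simp add: assms(1))
  also have "\<dots> = (\<Sum>k\<le>n. (x gchoose k) * (A * s ^ k) $ n)"
    by (simp add: fps_mult_compose_nth[OF assms(2)])
  finally show "poly (Q n) x = poly (\<Sum>k\<le>n. smult ((A * s ^ k) $ n) (binomial_poly k)) x"
    by (simp add: poly_sum mult.commute)
qed

text \<open>
In the binomial expansion of \<open>Q n\<close> the coefficient of the basis element of degree \<open>n\<close> is
\<open>A(0) s'(0)^n\<close>.
\<close>

lemma degree_generated_poly:
  fixes A s :: "complex fps"
  assumes "\<And>x. A * (fps_binomial x oo s) = Abs_fps (\<lambda>n. poly (Q n) x)" and "s $ 0 = 0"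
    and "A $ 0 \<noteq> 0" and "s $ 1 \<noteq> 0"
  shows "Q n \<noteq> 0 \<and> degree (Q n) = n"
proof -
  have "(A * s ^ n) $ n = (\<Sum>i=0..n. if i = 0 then A $ 0 * s ^ n $ n else 0)"
    unfolding fps_mult_nth using startsby_zero_power_prefix[OF assms(2)]
    by (intro sum.cong) auto
  then have "(A * s ^ n) $ n \<noteq> 0"
    using assms(3,4) by (simp add: startsby_zero_power_nth_same[OF assms(2)])
  moreover have "coeff (Q n) n = (A * s ^ n) $ n * coeff (binomial_poly n) n"
  proof -
    have "coeff (Q n) n = (\<Sum>k\<le>n. if k = n then (A * s ^ n) $ n * coeff (binomial_poly n) n else 0)"
      unfolding generated_poly_expansion[OF assms(1,2), of n] coeff_sum
      by (intro sum.cong) (auto simp: coeff_eq_0)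
    then show ?thesis by simp
  qed
  moreover have "coeff (binomial_poly n) n \<noteq> 0"
    using leading_coeff_0_iff[of "binomial_poly n"] by simp
  ultimately have "coeff (Q n) n \<noteq> 0" by simp
  moreover have "degree (Q n) \<le> n"
    unfolding generated_poly_expansion[OF assms(1,2), of n]
    by (intro degree_sum_le order.trans[OF degree_smult_le]) auto
  ultimately show ?thesis
    by (metis coeff_0 le_antisym le_degree)
qed

text \<open>
Formally, \<open>binomial_transform L f\<close> is the value of \<open>L\<close>, acting on the variable \<open>x\<close>, at
\<open>f(x) (1 + y)^x\<close>, as a power series in \<open>y\<close>.
\<close>

definition binomial_transform :: "(complex poly \<Rightarrow> complex) \<Rightarrow> complex poly \<Rightarrow> complex fps" where
  "binomial_transform L f = Abs_fps (\<lambda>k. L (f * binomial_poly k))"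

lemma binomial_transform_smult:
  assumes "linear_functional L"
  shows "binomial_transform L (smult a f) = fps_const a * binomial_transform L f"
  by (rule fps_ext) (simp add: binomial_transform_def linear_functional_smult[OF assms])

lemma binomial_transform_diff:
  assumes "linear_functional L"
  shows "binomial_transform L (f - g) = binomial_transform L f - binomial_transform L g"
  by (rule fps_ext)
    (simp add: binomial_transform_def left_diff_distrib linear_functional_diff[OF assms])

text \<open>
Applying \<open>L\<close> to \<open>f(x) A(t) (1 + s(t))^x\<close> amounts to substituting \<open>y = s(t)\<close> in the binomial
transform, so all values \<open>L (f * Q n)\<close> can be read off a single power series.
\<close>

lemma binomial_transform_generated:
  assumes "\<And>x. A * (fps_binomial x oo s) = Abs_fps (\<lambda>n. poly (Q n) x)" and "s $ 0 = 0"
    and L: "linear_functional L"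
  shows "Abs_fps (\<lambda>n. L (f * Q n)) = A * (binomial_transform L f oo s)"
proof (rule fps_ext)
  fix n
  show "Abs_fps (\<lambda>n. L (f * Q n)) $ n = (A * (binomial_transform L f oo s)) $ n"
    by (simp add: fps_mult_compose_nth[OF assms(2)] generated_poly_expansion[OF assms(1,2), of n]
        binomial_transform_def sum_distrib_left linear_functional_sum[OF L]
        linear_functional_smult[OF L] mult.commute)
qed

text \<open>
Differentiation in \<open>y\<close> brings down the factor \<open>x\<close>: \<open>x (1 + y)^x = (1 + y) (d/dy) (1 + y)^x\<close>.
\<close>

lemma binomial_transform_X_mult:
  assumes L: "linear_functional L"
  shows "binomial_transform L ([:0, 1:] * f) = (1 + fps_X) * fps_deriv (binomial_transform L f)"
proof (rule fps_ext)
  fix k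
  have "[:0, 1:] * f * binomial_poly k = f * ([:0, 1:] * binomial_poly k)"
    by (simp only: mult_ac)
  also have "\<dots> = smult (of_nat k) (f * binomial_poly k)
      + smult (of_nat (Suc k)) (f * binomial_poly (Suc k))"
    by (simp only: X_mult_binomial_poly distrib_left mult_smult_right)
  finally have "L ([:0, 1:] * f * binomial_poly k) = of_nat k * L (f * binomial_poly k)
      + of_nat (Suc k) * L (f * binomial_poly (Suc k))"
    by (simp only: linear_functional_add[OF L] linear_functional_smult[OF L])
  moreover have "((1 + fps_X) * fps_deriv (binomial_transform L f)) $ k =
      of_nat k * L (f * binomial_poly k) + of_nat (Suc k) * L (f * binomial_poly (Suc k))"
    by (cases k) (simp_all add: binomial_transform_def distrib_right)
  ultimately show "binomial_transform L ([:0, 1:] * f) $ k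
      = ((1 + fps_X) * fps_deriv (binomial_transform L f)) $ k"
    by (simp only: binomial_transform_def fps_nth_Abs_fps)
qed

section \<open>The Meixner functional on generating functions\<close>

text \<open>
With \<open>\<delta> = - \<gamma>\<close> and \<open>\<zeta> = - z\<close> the value at \<open>binomial_poly k\<close> is \<open>(\<gamma>)\<^sub>k z\<^sup>k / k!\<close>, which is the
\<open>k\<close>-th binomial moment of Meixner's weight \<open>(1 - w)\<^sup>\<gamma> (\<gamma>)\<^sub>j w\<^sup>j / j!\<close> on the natural numbers for
\<open>w = z / (1 + z)\<close>. The signs are chosen so that the functional maps \<open>(1 + y)^x\<close> to the plain
binomial series \<open>(1 + \<zeta> y)^\<delta>\<close>.
\<close>

definition meixner_functional :: "complex \<Rightarrow> complex \<Rightarrow> complex poly \<Rightarrow> complex" where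
  "meixner_functional \<delta> \<zeta> = functional_of_moments (\<lambda>k. (\<delta> gchoose k) * \<zeta> ^ k)"

lemma linear_meixner_functional: "linear_functional (meixner_functional \<delta> \<zeta>)"
  by (simp add: meixner_functional_def linear_functional_of_moments)

text \<open>
For \<open>n = 0\<close> this is \<open>(1 + \<zeta> y)^\<delta>\<close>. The step from \<open>n\<close> to \<open>n + 1\<close> uses
\<open>(n + 1) (x choose n + 1) = (x - n) (x choose n)\<close>, that is, it applies the operator
\<open>(1 + y) d/dy - n\<close>; the derivative of the factor \<open>(1 + y)^n\<close> is cancelled by the term \<open>- n\<close>, and
only the derivative of \<open>(1 + \<zeta> y)^(\<delta> - n)\<close> survives.
\<close>

lemma binomial_transform_meixner:
  "binomial_transform (meixner_functional \<delta> \<zeta>) (binomial_poly n) =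
     fps_const ((\<delta> gchoose n) * \<zeta> ^ n) * (1 + fps_X) ^ n *
     (fps_binomial (\<delta> - of_nat n) oo (fps_const \<zeta> * fps_X))"
proof (induction n)
  case 0
  have "fps_binomial \<delta> oo (fps_const \<zeta> * fps_X) = Abs_fps (\<lambda>k. (\<delta> gchoose k) * \<zeta> ^ k)"
    unfolding fps_compose_linear by (simp add: mult.commute)
  then show ?case
    by (simp add: binomial_transform_def meixner_functional_def)
next
  case (Suc n)
  let ?L = "meixner_functional \<delta> \<zeta>"
  let ?T = "binomial_transform ?L"
  define E where "E k = fps_binomial (\<delta> - of_nat k) oo (fps_const \<zeta> * fps_X)" for k
  define C where "C = (\<delta> gchoose n) * \<zeta> ^ n"
  have dE: "fps_deriv (E n) = fps_const (\<zeta> * (\<delta> - of_nat n)) * E (Suc n)"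
    by (simp add: E_def fps_compose_deriv fps_deriv_binomial_shift fps_compose_mult_distrib
        diff_diff_eq add.commute mult_ac flip: fps_const_mult)
  have power_rule: "(1 + fps_X) * fps_deriv ((1 + fps_X) ^ n) = fps_const (of_nat n) * (1 + fps_X :: complex fps) ^ n"
    unfolding fps_deriv_power' by (cases n) (simp_all add: fps_of_nat mult_ac del: of_nat_Suc)
  \<comment> \<open>The factors are kept opaque, since the simplifier would expand the derivative of the power.\<close>
  have product_rule: "W * fps_deriv (fps_const C * Z * F) =
      fps_const C * (W * fps_deriv Z) * F + fps_const C * W * Z * fps_deriv F" for W Z F
    by (simp add: algebra_simps)
  have IH: "?T (binomial_poly n) = fps_const C * (1 + fps_X) ^ n * E n"
    using Suc.IH by (simp add: C_def E_def)
  have "smult (of_nat (Suc n)) (binomial_poly (Suc n)) =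
      [:0, 1:] * binomial_poly n - smult (of_nat n) (binomial_poly n)"
    unfolding X_mult_binomial_poly by simp
  then have "fps_const (of_nat (Suc n)) * ?T (binomial_poly (Suc n)) =
      ?T ([:0, 1:] * binomial_poly n) - fps_const (of_nat n) * ?T (binomial_poly n)"
    by (metis binomial_transform_smult[OF linear_meixner_functional]
        binomial_transform_diff[OF linear_meixner_functional])
  also have "?T ([:0, 1:] * binomial_poly n) =
      (1 + fps_X) * fps_deriv (fps_const C * (1 + fps_X) ^ n * E n)"
    unfolding binomial_transform_X_mult[OF linear_meixner_functional] IH ..
  also have "\<dots> - fps_const (of_nat n) * ?T (binomial_poly n) =
      fps_const (C * \<zeta> * (\<delta> - of_nat n)) * (1 + fps_X) ^ Suc n * E (Suc n)"
    unfolding IH product_rule power_rule dE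
    by (simp add: mult_ac flip: fps_const_mult)
  also have "C * \<zeta> * (\<delta> - of_nat n) = of_nat (Suc n) * ((\<delta> gchoose Suc n) * \<zeta> ^ Suc n)"
  proof -
    have "(\<delta> - of_nat n) * (\<delta> gchoose n) = of_nat (Suc n) * (\<delta> gchoose Suc n)"
      by (simp only: gbinomial_absorption gbinomial_absorb_comp)
    moreover have "C * \<zeta> * (\<delta> - of_nat n) = (\<delta> - of_nat n) * (\<delta> gchoose n) * \<zeta> ^ Suc n"
      by (simp add: C_def mult_ac)
    ultimately show ?thesis
      by (simp only: mult.assoc)
  qed
  finally have "fps_const (of_nat (Suc n)) * ?T (binomial_poly (Suc n)) =
      fps_const (of_nat (Suc n)) *
      (fps_const ((\<delta> gchoose Suc n) * \<zeta> ^ Suc n) * (1 + fps_X) ^ Suc n * E (Suc n))"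
    by (simp only: mult.assoc fps_const_mult[symmetric])
  then show ?case
    by (simp add: E_def del: of_nat_Suc)
qed

text \<open>
The substitution is made for the choice \<open>\<zeta> s = (1 - t)^(-d) - 1\<close>: then
\<open>(1 + \<zeta> s)^(\<delta> - n) = (1 - t)^(- d (\<delta> - n))\<close>, the prefactor \<open>(1 - t)^(d \<delta> + i)\<close> cancels the
non-integral part of the exponent, and \<open>(1 - t)^(i + d n)\<close> remains. Of the latter the factor
\<open>(1 - t)^(d n)\<close> clears the denominator of \<open>(1 + s)^n\<close>. The result is a polynomial in \<open>t\<close>; this is
what makes all but finitely many of the values of the functional vanish.
\<close>

lemma meixner_functional_generating_function:
  fixes d i :: nat
  assumes \<zeta>: "\<zeta> * a = 1"
    and s: "s = fps_const a * (inverse ((1 - fps_X) ^ d) - 1)"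
  shows "one_minus_X_powr (of_nat d * \<delta> + of_nat i) *
           (binomial_transform (meixner_functional \<delta> \<zeta>) (binomial_poly n) oo s) =
         fps_const (\<delta> gchoose n) * (1 - fps_X) ^ i *
           (1 - fps_const (1 - \<zeta>) * (1 - fps_X) ^ d) ^ n"
proof -
  have s0: "s $ 0 = 0"
    by (simp add: s fps_power_zeroth)
  let ?Y = "(1 - fps_X) ^ d :: complex fps"
  have inv: "inverse ?Y * ?Y = 1"
    by (rule inverse_mult_eq_1) (simp add: fps_power_zeroth)
  have \<zeta>s: "fps_const \<zeta> * s = one_minus_X_powr (- of_nat d) - 1"
    by (simp add: s one_minus_X_powr_minus_of_nat \<zeta> flip: mult.assoc)
  have "fps_binomial (\<delta> - of_nat n) oo (fps_const \<zeta> * fps_X) oo s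
      = one_minus_X_powr (- of_nat d * (\<delta> - of_nat n))"
    using \<zeta>s fps_binomial_compose_one_minus_X_powr
    by (simp add: fps_compose_assoc[symmetric] s0 fps_compose_mult_distrib)
  then have transform: "binomial_transform (meixner_functional \<delta> \<zeta>) (binomial_poly n) oo s =
      fps_const ((\<delta> gchoose n) * \<zeta> ^ n) * (1 + s) ^ n *
      one_minus_X_powr (- of_nat d * (\<delta> - of_nat n))"
    by (simp add: binomial_transform_meixner fps_compose_mult_distrib[OF s0]
        fps_compose_power[OF s0, symmetric] fps_compose_add_distrib s0)
  have weight: "one_minus_X_powr (of_nat d * \<delta> + of_nat i) *
      one_minus_X_powr (- of_nat d * (\<delta> - of_nat n)) = (1 - fps_X) ^ i * ?Y ^ n"
  proof -
    have "of_nat d * \<delta> + of_nat i + - of_nat d * (\<delta> - of_nat n) = of_nat (i + d * n)"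
      by (simp add: algebra_simps)
    then show ?thesis
      by (metis one_minus_X_powr_add one_minus_X_powr_of_nat power_add power_mult)
  qed
  have "one_minus_X_powr (of_nat d * \<delta> + of_nat i) *
           (binomial_transform (meixner_functional \<delta> \<zeta>) (binomial_poly n) oo s) =
      fps_const ((\<delta> gchoose n) * \<zeta> ^ n) * (1 + s) ^ n * ((1 - fps_X) ^ i * ?Y ^ n)"
    unfolding transform by (subst mult.left_commute) (simp only: weight)
  also have "\<dots> = fps_const (\<delta> gchoose n) * (1 - fps_X) ^ i * ((fps_const \<zeta> + fps_const \<zeta> * s) * ?Y) ^ n"
  proof -
    have "fps_const \<zeta> + fps_const \<zeta> * s = fps_const \<zeta> * (1 + s)"
      by (simp add: distrib_left)
    then show ?thesis
      by (simp add: power_mult_distrib mult_ac flip: fps_const_mult fps_const_power)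
  qed
  also have "(fps_const \<zeta> + fps_const \<zeta> * s) * ?Y = 1 - fps_const (1 - \<zeta>) * ?Y"
    unfolding \<zeta>s one_minus_X_powr_minus_of_nat using inv
    by (simp add: algebra_simps flip: fps_const_sub)
  finally show ?thesis .
qed

section \<open>The Meixner functional as a series, and its continuation\<close>

lemma binomial_series_abs_summable:
  fixes \<delta> v :: complex
  assumes "norm v < 1"
  shows "summable (\<lambda>j. norm ((\<delta> gchoose j) * v ^ j))"
proof -
  \<comment> \<open>Compare with the convergent series at a point of larger modulus.\<close>
  obtain r where r: "norm v < r" "r < 1"
    using dense[OF assms] by blast
  then have "0 < r"
    using norm_ge_zero[of v] by linarith
  then have "norm (complex_of_real r) = r" by simp
  then have "summable (\<lambda>j. (\<delta> gchoose j) * complex_of_real r ^ j)"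
    using gen_binomial_complex[of "complex_of_real r" \<delta>] r sums_summable by auto
  then show ?thesis
    by (rule powser_insidea) (use r \<open>norm (complex_of_real r) = r\<close> in simp)
qed

text \<open>
By trinomial revision the terms from \<open>k\<close> onwards form a multiple of the binomial series with
exponent \<open>\<delta> - k\<close>, and those before \<open>k\<close> vanish.
\<close>

lemma weighted_binomial_series:
  fixes \<delta> v :: complex
  assumes "norm v < 1"
  shows "summable (\<lambda>j. norm ((\<delta> gchoose j) * v ^ j * (of_nat j gchoose k)))"
    and "(\<lambda>j. (\<delta> gchoose j) * v ^ j * (of_nat j gchoose k)) sums
           ((\<delta> gchoose k) * v ^ k * (1 + v) powr (\<delta> - of_nat k))"
proof -
  let ?t = "\<lambda>j. (\<delta> gchoose j) * v ^ j * (of_nat j gchoose k :: complex)"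
  let ?b = "\<lambda>m. ((\<delta> - of_nat k) gchoose m) * v ^ m"
  have shift: "?t (m + k) = (\<delta> gchoose k) * v ^ k * ?b m" for m
    using gbinomial_trinomial_revision[of k "m + k" \<delta>] by (simp add: power_add mult_ac)
  have "(\<Sum>j<k. ?t j) = 0"
    by (intro sum.neutral) (simp add: binomial_gbinomial[symmetric])
  moreover have "(\<lambda>m. ?t (m + k)) sums ((\<delta> gchoose k) * v ^ k * (1 + v) powr (\<delta> - of_nat k))"
    unfolding shift by (intro sums_mult gen_binomial_complex assms)
  ultimately show "?t sums ((\<delta> gchoose k) * v ^ k * (1 + v) powr (\<delta> - of_nat k))"
    using sums_iff_shift[of ?t k] by (simp only: add_0_right)
  have "summable (\<lambda>m. norm (?t (m + k)))"
    unfolding shift norm_mult[of "_ * v ^ k"]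
    by (intro summable_mult binomial_series_abs_summable assms)
  then show "summable (\<lambda>j. norm (?t j))"
    using summable_iff_shift[of "\<lambda>j. norm (?t j)" k] by blast
qed

text \<open>
By the Newton expansion of \<open>f\<close> it suffices to sum the series for the binomial basis.
\<close>

lemma meixner_functional_series:
  fixes \<delta> v :: complex
  assumes v: "norm v < 1"
  shows "summable (\<lambda>j. norm ((\<delta> gchoose j) * v ^ j * poly f (of_nat j)))"
    and "(\<lambda>j. (\<delta> gchoose j) * v ^ j * poly f (of_nat j)) sums
           ((1 + v) powr \<delta> * meixner_functional \<delta> (v / (1 + v)) f)"
proof -
  let ?c = "\<lambda>k. newton_coeff k f"
  let ?t = "\<lambda>k j. (\<delta> gchoose j) * v ^ j * (of_nat j gchoose k :: complex)"
  have nz: "1 + v \<noteq> 0"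
    using v by (metis add_eq_0_iff norm_minus_cancel norm_one order_less_irrefl)
  have expand: "(\<delta> gchoose j) * v ^ j * poly f (of_nat j) = (\<Sum>k\<le>degree f. ?c k * ?t k j)" for j
  proof -
    have "poly f (of_nat j) = (\<Sum>k\<le>degree f. ?c k * (of_nat j gchoose k))"
      by (subst newton_expansion[of f "degree f"]) (simp_all add: poly_sum)
    then show ?thesis by (simp add: sum_distrib_left mult_ac)
  qed
  have "summable (\<lambda>j. \<Sum>k\<le>degree f. norm (?c k * ?t k j))"
    unfolding norm_mult[of "?c _"]
    by (intro summable_sum summable_mult weighted_binomial_series v)
  then show "summable (\<lambda>j. norm ((\<delta> gchoose j) * v ^ j * poly f (of_nat j)))"
    unfolding expand by (rule summable_comparison_test'[where N = 0]) (simp add: norm_sum)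
  have "(\<lambda>j. \<Sum>k\<le>degree f. ?c k * ?t k j) sums
      (\<Sum>k\<le>degree f. ?c k * ((\<delta> gchoose k) * v ^ k * (1 + v) powr (\<delta> - of_nat k)))"
    by (intro sums_sum sums_mult weighted_binomial_series v)
  also have "(\<Sum>k\<le>degree f. ?c k * ((\<delta> gchoose k) * v ^ k * (1 + v) powr (\<delta> - of_nat k))) =
      (1 + v) powr \<delta> * meixner_functional \<delta> (v / (1 + v)) f"
    using nz by (simp add: meixner_functional_def functional_of_moments_def sum_distrib_left
        powr_diff power_divide powr_nat' mult_ac)
  finally show "(\<lambda>j. (\<delta> gchoose j) * v ^ j * poly f (of_nat j)) sums
           ((1 + v) powr \<delta> * meixner_functional \<delta> (v / (1 + v)) f)"
    unfolding expand .
qed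

text \<open>
The principal branch is compatible with inversion off the negative real axis.
\<close>

lemma complex_inverse_powr_if_Re_pos:
  fixes w a :: complex
  assumes "0 < Re w"
  shows "inverse w powr a = w powr (- a)"
proof -
  have "w \<notin> \<real>\<^sub>\<le>\<^sub>0" using assms by (auto simp: complex_nonpos_Reals_iff)
  moreover have "w \<noteq> 0" using assms by auto
  ultimately show ?thesis by (simp add: powr_def Ln_inverse)
qed

text \<open>
In terms of the parameters of the theorem, \<open>\<zeta> = dc / (c - 1)\<close>; it is the reciprocal of the factor
\<open>(c - 1) / (dc)\<close> in the generating function. The values of \<open>c\<close> excluded by admissibility are those
for which \<open>\<zeta>\<close> is undefined, \<open>0\<close> or \<open>1\<close>.
\<close>

definition meixner_parameter :: "nat \<Rightarrow> complex \<Rightarrow> complex" where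
  "meixner_parameter d c = of_nat d * c / (c - 1)"

lemma functional_term_eq:
  fixes d i :: nat and \<beta> c :: complex
  defines "\<zeta> \<equiv> meixner_parameter d c" and "\<gamma> \<equiv> \<beta> + of_nat i / of_nat d"
  assumes "1 - \<zeta> \<noteq> 0"
  shows "functional_term d \<beta> c i f j =
    inverse ((1 - \<zeta>) powr \<gamma>) * ((- \<gamma> gchoose j) * (\<zeta> / (1 - \<zeta>)) ^ j * poly f (of_nat j))"
proof -
  have "of_nat d * c / (1 - c) = - \<zeta>"
    unfolding \<zeta>_def meixner_parameter_def by (metis minus_diff_eq minus_divide_right)
  then have "functional_term d \<beta> c i f j =
      pochhammer \<gamma> j * (- \<zeta>) ^ j / ((1 - \<zeta>) powr (\<gamma> + of_nat j) * fact j) * poly f (of_nat j)"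
    by (simp add: functional_term_def \<gamma>_def \<zeta>_def meixner_parameter_def)
  also have "(1 - \<zeta>) powr (\<gamma> + of_nat j) = (1 - \<zeta>) powr \<gamma> * (1 - \<zeta>) ^ j"
    using assms(3) by (simp add: powr_add powr_nat')
  also have "pochhammer \<gamma> j * (- \<zeta>) ^ j = fact j * (- \<gamma> gchoose j) * \<zeta> ^ j"
    by (simp add: gbinomial_pochhammer power_minus[of \<zeta>])
  finally show ?thesis
    by (simp add: field_simps)
qed

text \<open>
Convergence means \<open>|v| < 1\<close> for \<open>v = \<zeta> / (1 - \<zeta>)\<close>. Then \<open>1 + v = 1 / (1 - \<zeta>)\<close> has positive real
part, so the power of \<open>1 - \<zeta>\<close> in the weight and the value \<open>(1 + v)^(- \<gamma>)\<close> of the binomial series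
cancel exactly, without a discrepancy of branches.
\<close>

lemma functional_term_sums:
  assumes c: "c \<in> convergence_domain d"
  shows "summable (\<lambda>j. norm (functional_term d \<beta> c i f j))"
    and "(\<Sum>j. functional_term d \<beta> c i f j) =
      meixner_functional (- (\<beta> + of_nat i / of_nat d)) (meixner_parameter d c) f"
proof -
  define \<zeta> where "\<zeta> = meixner_parameter d c"
  define \<gamma> where "\<gamma> = \<beta> + of_nat i / of_nat d"
  define v where "v = \<zeta> / (1 - \<zeta>)"
  have "norm (of_nat d * c / (1 - c)) = norm \<zeta>"
    by (simp add: \<zeta>_def meixner_parameter_def norm_divide norm_minus_commute)
  then have less: "norm \<zeta> < norm (1 - \<zeta>)"
    using c by (simp add: convergence_domain_def \<zeta>_def meixner_parameter_def)
  then have nz: "1 - \<zeta> \<noteq> 0" by auto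
  have v: "norm v < 1"
    using less nz by (simp add: v_def norm_divide divide_less_eq_1)
  have one_v: "1 + v = inverse (1 - \<zeta>)" and \<zeta>v: "v / (1 + v) = \<zeta>"
    using nz by (simp_all add: v_def field_simps)
  have "0 < Re (1 + v)"
    using v abs_Re_le_cmod[of v] by simp
  then have "inverse ((1 - \<zeta>) powr \<gamma>) * (1 + v) powr (- \<gamma>) = 1"
    using complex_inverse_powr_if_Re_pos[of "1 + v" \<gamma>] nz by (simp add: one_v)
  then have K: "inverse ((1 - \<zeta>) powr \<gamma>) * ((1 + v) powr (- \<gamma>) * M) = M" for M
    by (metis mult.assoc mult_1)
  have t: "functional_term d \<beta> c i f j =
      inverse ((1 - \<zeta>) powr \<gamma>) * ((- \<gamma> gchoose j) * v ^ j * poly f (of_nat j))" for j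
    using functional_term_eq[of d c \<beta> i f j] nz by (simp add: \<zeta>_def \<gamma>_def v_def)
  show "summable (\<lambda>j. norm (functional_term d \<beta> c i f j))"
    unfolding t norm_mult[of "inverse _"]
    by (intro summable_mult meixner_functional_series v)
  have "(\<lambda>j. functional_term d \<beta> c i f j) sums meixner_functional (- \<gamma>) \<zeta> f"
    unfolding t
    using sums_mult[OF meixner_functional_series(2)[OF v, of "- \<gamma>" f], of "inverse ((1 - \<zeta>) powr \<gamma>)"]
    by (simp only: K \<zeta>v)
  then show "(\<Sum>j. functional_term d \<beta> c i f j) =
      meixner_functional (- (\<beta> + of_nat i / of_nat d)) (meixner_parameter d c) f"
    by (simp add: sums_iff \<gamma>_def \<zeta>_def)
qed

definition continued_functional ::
    "nat \<Rightarrow> complex \<Rightarrow> complex \<Rightarrow> nat \<Rightarrow> complex poly \<Rightarrow> complex" where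
  "continued_functional d \<beta> c r f =
     1 / fact r * (\<Sum>i=0..r. of_nat (r choose i) * (-1) ^ i *
       meixner_functional (- (\<beta> + of_nat i / of_nat d)) (meixner_parameter d c) f)"

lemma series_functional_eq_continued:
  assumes "c \<in> convergence_domain d"
  shows "series_functional d \<beta> c = continued_functional d \<beta> c"
  by (intro ext) (simp add: series_functional_def continued_functional_def functional_term_sums(2)[OF assms])

text \<open>
For fixed \<open>f\<close> the functional is a polynomial in \<open>meixner_parameter d c\<close>, hence a rational function
of \<open>c\<close> whose only possible pole is at \<open>1\<close>.
\<close>

lemma continues_continued_functional:
  "continues_series_functional d \<beta> (continued_functional d \<beta>)"
  unfolding continues_series_functional_def
proof (intro allI impI conjI ballI)
  fix r f
  show "(\<lambda>c. continued_functional d \<beta> c r f) holomorphic_on admissible d"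
    unfolding continued_functional_def meixner_functional_def functional_of_moments_def
      meixner_parameter_def
    by (intro holomorphic_intros) (auto simp: admissible_def)
qed (simp add: series_functional_eq_continued)

lemma linear_continued_functional: "linear_functional (continued_functional d \<beta> c r)"
  by (simp add: linear_functional_iff continued_functional_def sum.distrib sum_distrib_left
      linear_functional_add[OF linear_meixner_functional]
      linear_functional_smult[OF linear_meixner_functional] algebra_simps)

section \<open>Proof of $d$-orthogonality\<close>

text \<open>
The polynomial \<open>q\<close> in \<open>t\<close> is the one found in the lemma \<open>meixner_functional_generating_function\<close>,
up to a scalar.
For \<open>\<zeta> = 1\<close> and \<open>n > 0\<close> its degree would drop; this corresponds to the excluded value
\<open>c = 1 / (1 - d)\<close>.
\<close>

lemma degree_and_lead_coeff_generating_poly: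
  fixes \<zeta> :: complex and d i n :: nat
  assumes "d \<ge> 1" and "\<zeta> \<noteq> 1"
  defines "q \<equiv> [:1, -1:] ^ i * (1 - smult (1 - \<zeta>) ([:1, -1:] ^ d)) ^ n"
  shows "degree q = n * d + i" and "lead_coeff q \<noteq> 0"
proof -
  have p: "degree ([:1, -1 :: complex:] ^ k) = k" "[:1, -1 :: complex:] ^ k \<noteq> 0" for k
    by (simp_all add: degree_power_eq)
  have e: "degree (1 - smult (1 - \<zeta>) ([:1, -1:] ^ d)) = d"
    using assms p by (subst diff_conv_add_uminus, subst degree_add_eq_right) simp_all
  then have "1 - smult (1 - \<zeta>) ([:1, -1:] ^ d) \<noteq> 0"
    using assms(1) by auto
  then have "q \<noteq> 0" and "degree q = n * d + i"
    using p e by (simp_all add: q_def degree_mult_eq degree_power_eq)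
  then show "degree q = n * d + i" and "lead_coeff q \<noteq> 0"
    using leading_coeff_0_iff by metis+
qed

text \<open>
The value of the \<open>i\<close>-th Meixner functional at \<open>binomial_poly n * P m\<close> is a multiple of the \<open>m\<close>-th
coefficient of a polynomial of degree \<open>n d + i\<close>. For \<open>i \<le> r\<close> and \<open>m > n d + r\<close> all of these
coefficients are zero; for \<open>m = n d + r\<close> only the leading coefficient for \<open>i = r\<close> is left, and the
condition on \<open>\<beta>\<close> makes its factor \<open>\<delta> r gchoose n\<close> nonzero.
\<close>

lemma continued_functional_on_basis:
  fixes P :: "nat \<Rightarrow> complex poly"
  assumes d: "d \<ge> 1" and c: "c \<in> admissible d"
    and \<beta>: "\<And>n::nat. \<beta> \<noteq> - (of_nat n / of_nat d)"
    and P: "generated_by d \<beta> c P"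
  shows "m > n * d + r \<Longrightarrow> continued_functional d \<beta> c r (binomial_poly n * P m) = 0"
    and "continued_functional d \<beta> c r (binomial_poly n * P (n * d + r)) \<noteq> 0"
    and "polynomial_set P"
proof -
  define a where "a = (c - 1) / (of_nat d * c)"
  define \<zeta> where "\<zeta> = meixner_parameter d c"
  define s where "s = fps_const a * (inverse ((1 - fps_X) ^ d) - 1)"
  define A where "A = one_minus_X_powr (- (\<beta> * of_nat d))"
  define Q where "Q n = smult (1 / fact n) (P n)" for n
  have d0: "of_nat d \<noteq> (0 :: complex)" using d by simp
  have c01: "c \<noteq> 0" "c \<noteq> 1" and "c \<noteq> 1 / (1 - of_nat d)"
    using c by (auto simp: admissible_def)
  have \<zeta>a: "\<zeta> * a = 1"
    using c01 d0 by (simp add: \<zeta>_def a_def meixner_parameter_def)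
  have \<zeta>1: "\<zeta> \<noteq> 1"
  proof
    assume "\<zeta> = 1"
    then have "c * (1 - of_nat d) = 1"
      using c01 by (simp add: \<zeta>_def meixner_parameter_def field_simps)
    then have "c = 1 / (1 - of_nat d)"
      by (metis mult_zero_right nonzero_eq_divide_eq zero_neq_one)
    with \<open>c \<noteq> 1 / (1 - of_nat d)\<close> show False by contradiction
  qed
  have s0: "s $ 0 = 0"
    by (simp add: s_def fps_power_zeroth)
  have s1: "s $ 1 \<noteq> 0"
  proof -
    have "s $ 1 = a * of_nat d"
      by (simp add: s_def fps_compose_nth flip: one_minus_X_powr_minus_of_nat)
    then show ?thesis using \<zeta>a d0 by auto
  qed
  have gen: "A * (fps_binomial x oo s) = Abs_fps (\<lambda>n. poly (Q n) x)" for x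
    using P by (simp add: generated_by_def fps_one_plus_powr_def A_def s_def a_def Q_def)
  have "polynomial_set Q"
    using degree_generated_poly[OF gen s0 _ s1] by (simp add: polynomial_set_def A_def)
  then show "polynomial_set P"
    by (simp add: polynomial_set_def Q_def)

  define q where "q i = [:1, -1:] ^ i * (1 - smult (1 - \<zeta>) ([:1, -1:] ^ d)) ^ n" for i
  define \<delta> where "\<delta> i = - (\<beta> + of_nat i / of_nat d)" for i :: nat
  have M: "meixner_functional (\<delta> i) \<zeta> (binomial_poly n * P m) =
      fact m * ((\<delta> i gchoose n) * coeff (q i) m)" for i m
  proof -
    let ?L = "meixner_functional (\<delta> i) \<zeta>"
    \<comment> \<open>The same prefactor serves every \<open>i\<close>, because \<open>\<delta> i\<close> is shifted by \<open>- i / d\<close>.\<close>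
    have \<delta>: "- (\<beta> * of_nat d) = of_nat d * \<delta> i + of_nat i"
      using d0 by (simp add: \<delta>_def field_simps)
    have "fps_of_poly [:1, -1 :: complex:] = 1 - fps_X"
      by (simp add: fps_of_poly_pCons)
    then have "Abs_fps (\<lambda>m. ?L (binomial_poly n * Q m)) = fps_const (\<delta> i gchoose n) * fps_of_poly (q i)"
      unfolding binomial_transform_generated[OF gen s0 linear_meixner_functional] A_def \<delta>
        meixner_functional_generating_function[OF \<zeta>a s_def]
      by (simp add: q_def fps_of_poly_mult fps_of_poly_power fps_of_poly_diff fps_of_poly_smult
          mult.assoc)
    then have "?L (binomial_poly n * Q m) = (\<delta> i gchoose n) * coeff (q i) m"
      by (metis fps_mult_left_const_nth fps_nth_Abs_fps fps_of_poly_nth)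
    then show ?thesis
      by (simp add: Q_def linear_functional_smult[OF linear_meixner_functional] field_simps)
  qed
  have U: "continued_functional d \<beta> c r (binomial_poly n * P m) =
      1 / fact r * (\<Sum>i=0..r. of_nat (r choose i) * (-1) ^ i *
        (fact m * ((\<delta> i gchoose n) * coeff (q i) m)))" for m
    unfolding continued_functional_def M[symmetric] by (simp add: \<delta>_def \<zeta>_def)
  note q = degree_and_lead_coeff_generating_poly[OF d \<zeta>1, of _ n, folded q_def]
  show "continued_functional d \<beta> c r (binomial_poly n * P m) = 0" if "m > n * d + r"
  proof -
    have "coeff (q i) m = 0" if "i \<le> r" for i
      using that \<open>m > n * d + r\<close> q(1)[of i] by (intro coeff_eq_0) auto
    then show ?thesis unfolding U by simp
  qed
  let ?N = "n * d + r"
  have "(\<Sum>i=0..r. of_nat (r choose i) * (-1) ^ i * (fact ?N * ((\<delta> i gchoose n) * coeff (q i) ?N)))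
      = (\<Sum>i=0..r. if i = r then (-1) ^ r * (fact ?N * ((\<delta> r gchoose n) * coeff (q r) ?N)) else 0)"
    using q(1) by (intro sum.cong) (auto simp: coeff_eq_0)
  then have "continued_functional d \<beta> c r (binomial_poly n * P ?N) =
      1 / fact r * ((-1) ^ r * (fact ?N * ((\<delta> r gchoose n) * lead_coeff (q r))))"
    unfolding U q(1) by simp
  moreover have "\<delta> r gchoose n \<noteq> 0"
  proof
    assume "\<delta> r gchoose n = 0"
    then have "pochhammer (- \<delta> r) n = 0"
      by (simp add: gbinomial_pochhammer)
    then obtain k where "- \<delta> r = - of_nat k"
      by (auto simp: pochhammer_eq_0_iff)
    then have "\<beta> = - of_nat k - of_nat r / of_nat d"
      by (simp add: \<delta>_def algebra_simps)
    then have "\<beta> = - (of_nat (k * d + r) / of_nat d)"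
      using d0 by (simp add: add_divide_distrib)
    with \<beta> show False by blast
  qed
  ultimately show "continued_functional d \<beta> c r (binomial_poly n * P ?N) \<noteq> 0"
    using q(2)[of r] by simp
qed

text \<open>
The binomial basis may be replaced by \<open>P\<close> itself: in the expansion of \<open>P n\<close> the basis elements of
degree \<open>k < n\<close> contribute nothing already from \<open>m > k d + r\<close> on, which includes \<open>m = n d + r\<close>, so
at that index only the top term counts.
\<close>

lemma d_orthogonal_wrt_continued_functional:
  fixes P :: "nat \<Rightarrow> complex poly"
  assumes d: "d \<ge> 1" and c: "c \<in> admissible d"
    and \<beta>: "\<And>n::nat. \<beta> \<noteq> - (of_nat n / of_nat d)"
    and P: "generated_by d \<beta> c P"
  shows "d_orthogonal_wrt d (continued_functional d \<beta> c) P"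
  unfolding d_orthogonal_wrt_def
proof (intro conjI allI impI)
  note basis = continued_functional_on_basis[OF assms]
  show PS: "polynomial_set P" by (rule basis(3))
  show "linear_functional (continued_functional d \<beta> c r)" for r
    by (rule linear_continued_functional)
  fix r n
  define u where "u = continued_functional d \<beta> c r"
  define b where "b k = newton_coeff k (P n)" for k
  have expand: "P n = (\<Sum>k\<le>n. smult (b k) (binomial_poly k))"
    using newton_expansion[of "P n" n] PS by (simp add: polynomial_set_def b_def)
  have u: "u (P n * P m) = (\<Sum>k\<le>n. b k * u (binomial_poly k * P m))" for m
    by (subst expand) (simp add: sum_distrib_right u_def
        linear_functional_sum[OF linear_continued_functional]
        linear_functional_smult[OF linear_continued_functional])
  have vanish: "u (binomial_poly k * P m) = 0" if "m > k * d + r" for k m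
    unfolding u_def using that by (rule basis(1))
  show "continued_functional d \<beta> c r (P n * P m) = 0" if "m > n * d + r" for m
  proof -
    have "u (binomial_poly k * P m) = 0" if "k \<le> n" for k
      using \<open>m > n * d + r\<close> mult_le_mono1[OF that, of d] by (intro vanish) linarith
    then show ?thesis
      using u unfolding u_def by simp
  qed
  let ?N = "n * d + r"
  have "u (binomial_poly k * P ?N) = 0" if "k < n" for k
    using that d by (intro vanish) simp
  then have "u (P n * P ?N) = (\<Sum>k\<le>n. if k = n then b n * u (binomial_poly n * P ?N) else 0)"
    unfolding u by (intro sum.cong) auto
  then have uN: "u (P n * P ?N) = b n * u (binomial_poly n * P ?N)" by simp
  have "b n \<noteq> 0"
  proof
    assume "b n = 0"
    then have "P n = (\<Sum>k<n. smult (b k) (binomial_poly k))"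
      using expand by (simp add: lessThan_Suc_atMost[symmetric])
    then have "coeff (P n) n = 0"
      by (simp add: coeff_sum coeff_eq_0)
    then show False
      using PS unfolding polynomial_set_def by (metis leading_coeff_0_iff)
  qed
  then show "continued_functional d \<beta> c r (P n * P ?N) \<noteq> 0"
    using uN basis(2)[of r n] by (simp add: u_def)
qed

theorem theorem2p7:
  fixes d :: nat and c \<beta> :: complex and P :: "nat \<Rightarrow> complex poly"
  assumes "d \<ge> 1"
    and "c \<in> admissible d"
    and "\<And>n::nat. \<beta> \<noteq> - (of_nat n / of_nat d)"
    and "generated_by d \<beta> c P"
  shows "(c \<in> convergence_domain d \<longrightarrow>
            (\<forall>i<d. \<forall>f. summable (\<lambda>j. norm (functional_term d \<beta> c i f j))) \<and>
            d_orthogonal_wrt d (series_functional d \<beta> c) P) \<and>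
         (\<exists>U. continues_series_functional d \<beta> U \<and> d_orthogonal_wrt d (U c) P)"
proof (intro conjI impI allI)
  have orth: "d_orthogonal_wrt d (continued_functional d \<beta> c) P"
    by (rule d_orthogonal_wrt_continued_functional[OF assms])
  show "summable (\<lambda>j. norm (functional_term d \<beta> c i f j))" if "c \<in> convergence_domain d" for i f
    by (rule functional_term_sums(1)[OF that])
  show "d_orthogonal_wrt d (series_functional d \<beta> c) P" if "c \<in> convergence_domain d"
    unfolding series_functional_eq_continued[OF that] by (rule orth)
  show "\<exists>U. continues_series_functional d \<beta> U \<and> d_orthogonal_wrt d (U c) P"
    using continues_continued_functional orth by blast
qed

end
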